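(* Let $(\mathcal{X}, d_{\mathcal{X}})$ be a non-empty compact metric space with diameter $D_{\mathcal{X}} > 0$, let $(x_n)_{n\in\mathbb{N}}$ be a basis of $\mathcal{X}$ and let $q>1$. Set $c_\varphi := \frac{\sqrt{q^2-1}}{q}$. The map $$\varphi : \mathcal{X} \longrightarrow \ell^2,\qquad x\longmapsto \left(\frac{c_\varphi\, d_{\mathcal{X}}(x,x_n)}{q^n}\right)_{n\in\mathbb{N}}$$ (which takes values in $\ell^2$) is 1-Lipschitz from $(\mathcal{X}, d_{\mathcal{X}})$ to $(\ell^2, \|\cdot\|_{\ell^2})$ and injective.
   Context: $\mathbb{N}$ includes $0$. A basis of $\mathcal{X}$ is a sequence $(x_n)_{n\in\mathbb{N}}$ of points of $\mathcal{X}$ (repetitions allowed) such that for every $x\in\mathcal{X}$ and $\varepsilon>0$ there is $n\in\mathbb{N}$ with $d_{\mathcal{X}}(x,x_n)\le\varepsilon$. $\ell^2$ is the Hilbert space of real square-summable sequences indexed by $\mathbb{N}$. The diameter is $D_{\mathcal{X}} := \max_{x,y\in\mathcal{X}} d_{\mathcal{X}}(x,y)$. *)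

theory Defs
  imports "HOL-Analysis.Analysis"
begin

section \<open>The Hilbert space of real square-summable sequences\<close>

typedef ell2 = "{a :: nat \<Rightarrow> real. summable (\<lambda>n. (a n)\<^sup>2)}"
  morphisms ell2_nth Abs_ell2
  by (rule exI[of _ "\<lambda>_. 0"]) simp

setup_lifting type_definition_ell2

lemma summable_mult_if_square_summable:
  fixes a b :: "nat \<Rightarrow> real"
  assumes "summable (\<lambda>n. (a n)\<^sup>2)" "summable (\<lambda>n. (b n)\<^sup>2)"
  shows "summable (\<lambda>n. a n * b n)"
proof (rule summable_comparison_test')
  show "summable (\<lambda>n. (a n)\<^sup>2 + (b n)\<^sup>2)"
    using assms by (rule summable_add)
next
  fix n :: nat
  have "2 * \<bar>a n * b n\<bar> \<le> (a n)\<^sup>2 + (b n)\<^sup>2"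
    using sum_squares_bound[of "\<bar>a n\<bar>" "\<bar>b n\<bar>"] by (simp add: abs_mult)
  then show "norm (a n * b n) \<le> (a n)\<^sup>2 + (b n)\<^sup>2"
    by simp
qed

lemma square_summable_add:
  fixes a b :: "nat \<Rightarrow> real"
  assumes "summable (\<lambda>n. (a n)\<^sup>2)" "summable (\<lambda>n. (b n)\<^sup>2)"
  shows "summable (\<lambda>n. (a n + b n)\<^sup>2)"
proof -
  have "summable (\<lambda>n. (a n)\<^sup>2 + (b n)\<^sup>2 + 2 * (a n * b n))"
    by (intro summable_add summable_mult summable_mult_if_square_summable assms)
  then show ?thesis
    by (simp add: power2_sum mult.assoc)
qed

lemma square_summable_scale:
  fixes a :: "nat \<Rightarrow> real"
  assumes "summable (\<lambda>n. (a n)\<^sup>2)"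
  shows "summable (\<lambda>n. (c * a n)\<^sup>2)"
  using summable_mult[OF assms, of "c\<^sup>2"] by (simp add: power_mult_distrib)

lemma square_summable_diff:
  fixes a b :: "nat \<Rightarrow> real"
  assumes "summable (\<lambda>n. (a n)\<^sup>2)" "summable (\<lambda>n. (b n)\<^sup>2)"
  shows "summable (\<lambda>n. (a n - b n)\<^sup>2)"
  using square_summable_add[OF assms(1) square_summable_scale[OF assms(2), of "-1"]] by simp

lemma summable_ell2_nth_square: "summable (\<lambda>n. (ell2_nth a n)\<^sup>2)"
  using ell2_nth[of a] by simp

instantiation ell2 :: real_inner
begin

lift_definition zero_ell2 :: ell2 is "\<lambda>_. 0" by simp

lift_definition plus_ell2 :: "ell2 \<Rightarrow> ell2 \<Rightarrow> ell2" is "\<lambda>a b n. a n + b n"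
  by (rule square_summable_add)

lift_definition minus_ell2 :: "ell2 \<Rightarrow> ell2 \<Rightarrow> ell2" is "\<lambda>a b n. a n - b n"
  by (rule square_summable_diff)

lift_definition uminus_ell2 :: "ell2 \<Rightarrow> ell2" is "\<lambda>a n. - a n"
  by simp

lift_definition scaleR_ell2 :: "real \<Rightarrow> ell2 \<Rightarrow> ell2" is "\<lambda>c a n. c * a n"
  by (rule square_summable_scale)

definition inner_ell2 :: "ell2 \<Rightarrow> ell2 \<Rightarrow> real"
  where "inner_ell2 a b = (\<Sum>n. ell2_nth a n * ell2_nth b n)"

definition norm_ell2 :: "ell2 \<Rightarrow> real"
  where "norm_ell2 a = sqrt (\<Sum>n. (ell2_nth a n)\<^sup>2)"

definition sgn_ell2 :: "ell2 \<Rightarrow> ell2"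
  where "sgn_ell2 a = inverse (norm a) *\<^sub>R a"

definition dist_ell2 :: "ell2 \<Rightarrow> ell2 \<Rightarrow> real"
  where "dist_ell2 a b = norm (a - b)"

definition uniformity_ell2 :: "(ell2 \<times> ell2) filter"
  where "uniformity_ell2 = (INF e\<in>{0 <..}. principal {(x, y). dist x y < e})"

definition open_ell2 :: "ell2 set \<Rightarrow> bool"
  where "open_ell2 U \<longleftrightarrow> (\<forall>x\<in>U. eventually (\<lambda>(x', y). x' = x \<longrightarrow> y \<in> U) uniformity)"

instance
proof
  fix a b c :: ell2 and r s :: real
  have mult_summable: "summable (\<lambda>n. ell2_nth u n * ell2_nth v n)" for u v
    by (intro summable_mult_if_square_summable summable_ell2_nth_square)
  show "a + b + c = a + (b + c)" "a + b = b + a" "0 + a = a" "- a + a = 0" "a - b = a + - b"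
    by (transfer; simp add: algebra_simps)+
  show "r *\<^sub>R (a + b) = r *\<^sub>R a + r *\<^sub>R b" "(r + s) *\<^sub>R a = r *\<^sub>R a + s *\<^sub>R a"
    "r *\<^sub>R s *\<^sub>R a = (r * s) *\<^sub>R a" "1 *\<^sub>R a = a"
    by (transfer; simp add: algebra_simps)+
  show "sgn a = inverse (norm a) *\<^sub>R a"
    by (simp add: sgn_ell2_def)
  show "dist a b = norm (a - b)"
    by (simp add: dist_ell2_def)
  show "(uniformity :: (ell2 \<times> ell2) filter) = (INF e\<in>{0 <..}. principal {(x, y). dist x y < e})"
    by (simp add: uniformity_ell2_def)
  show "open U \<longleftrightarrow> (\<forall>x\<in>U. eventually (\<lambda>(x', y). x' = x \<longrightarrow> y \<in> U) uniformity)" for U :: "ell2 set"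
    by (simp add: open_ell2_def)
  show "inner a b = inner b a"
    by (simp add: inner_ell2_def mult.commute)
  show "inner (a + b) c = inner a c + inner b c"
    by (simp add: inner_ell2_def plus_ell2.rep_eq distrib_right suminf_add[OF mult_summable mult_summable])
  show "inner (r *\<^sub>R a) b = r * inner a b"
    by (simp add: inner_ell2_def scaleR_ell2.rep_eq mult.assoc suminf_mult[OF mult_summable])
  show "0 \<le> inner a a"
    unfolding inner_ell2_def by (intro suminf_nonneg mult_summable) simp
  show "inner a a = 0 \<longleftrightarrow> a = 0"
    unfolding inner_ell2_def
    by (subst suminf_eq_zero_iff[OF mult_summable])
      (auto simp: zero_ell2.rep_eq ell2_nth_inject[symmetric])
  show "norm a = sqrt (inner a a)"
    by (simp add: norm_ell2_def inner_ell2_def power2_eq_square)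
qed

end

lemma norm_ell2_square: "(norm a)\<^sup>2 = (\<Sum>n. (ell2_nth a n)\<^sup>2)"
  unfolding norm_ell2_def
  by (rule real_sqrt_pow2) (intro suminf_nonneg summable_ell2_nth_square, simp)

lemma sum_ell2_nth_square_le: "(\<Sum>n<k. (ell2_nth a n)\<^sup>2) \<le> (norm a)\<^sup>2"
  unfolding norm_ell2_square
  by (intro sum_le_suminf summable_ell2_nth_square) auto

lemma abs_ell2_nth_le_norm: "\<bar>ell2_nth a n\<bar> \<le> norm a"
proof -
  have "(ell2_nth a n)\<^sup>2 \<le> (\<Sum>i<Suc n. (ell2_nth a i)\<^sup>2)"
    by (simp add: sum_nonneg)
  also have "\<dots> \<le> (norm a)\<^sup>2"
    by (rule sum_ell2_nth_square_le)
  finally show ?thesis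
    by (metis norm_ge_zero abs_le_square_iff abs_of_nonneg)
qed

instance ell2 :: complete_space
proof
  fix X :: "nat \<Rightarrow> ell2"
  assume X: "Cauchy X"
  have "Cauchy (\<lambda>k. ell2_nth (X k) n)" for n
  proof (rule metric_CauchyI)
    fix e :: real
    assume "e > 0"
    then obtain M where M: "\<And>k m. k \<ge> M \<Longrightarrow> m \<ge> M \<Longrightarrow> dist (X k) (X m) < e"
      using metric_CauchyD[OF X] by blast
    have "dist (ell2_nth (X k) n) (ell2_nth (X m) n) \<le> dist (X k) (X m)" for k m
      using abs_ell2_nth_le_norm[of "X k - X m" n]
      by (simp add: dist_norm minus_ell2.rep_eq)
    then show "\<exists>M. \<forall>k\<ge>M. \<forall>m\<ge>M. dist (ell2_nth (X k) n) (ell2_nth (X m) n) < e"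
      using M by (meson le_less_trans)
  qed
  then have "\<exists>l. (\<lambda>k. ell2_nth (X k) n) \<longlonglongrightarrow> l" for n
    by (simp add: Cauchy_convergent_iff convergent_def)
  then obtain l where l: "\<And>n. (\<lambda>k. ell2_nth (X k) n) \<longlonglongrightarrow> l n"
    by metis
  have tail: "\<exists>M. \<forall>k\<ge>M. \<forall>N. (\<Sum>n<N. (ell2_nth (X k) n - l n)\<^sup>2) \<le> e\<^sup>2" if "e > 0" for e
  proof -
    obtain M where M: "\<And>k m. k \<ge> M \<Longrightarrow> m \<ge> M \<Longrightarrow> dist (X k) (X m) < e"
      using metric_CauchyD[OF X \<open>e > 0\<close>] by blast
    have "(\<Sum>n<N. (ell2_nth (X k) n - l n)\<^sup>2) \<le> e\<^sup>2" if "k \<ge> M" for k N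
    proof (rule LIMSEQ_le_const2)
      show "(\<lambda>m. \<Sum>n<N. (ell2_nth (X k) n - ell2_nth (X m) n)\<^sup>2)
          \<longlonglongrightarrow> (\<Sum>n<N. (ell2_nth (X k) n - l n)\<^sup>2)"
        by (intro tendsto_intros l)
      have "(\<Sum>n<N. (ell2_nth (X k) n - ell2_nth (X m) n)\<^sup>2) \<le> e\<^sup>2" if "m \<ge> M" for m
      proof -
        have "(\<Sum>n<N. (ell2_nth (X k) n - ell2_nth (X m) n)\<^sup>2) \<le> (norm (X k - X m))\<^sup>2"
          using sum_ell2_nth_square_le[of "X k - X m" N] by (simp add: minus_ell2.rep_eq)
        also have "\<dots> \<le> e\<^sup>2"
          using M[OF \<open>k \<ge> M\<close> \<open>m \<ge> M\<close>] by (intro power_mono) (auto simp: dist_norm)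
        finally show ?thesis .
      qed
      then show "\<exists>K. \<forall>m\<ge>K. (\<Sum>n<N. (ell2_nth (X k) n - ell2_nth (X m) n)\<^sup>2) \<le> e\<^sup>2"
        by blast
    qed
    then show ?thesis by blast
  qed
  have diff_summable: "summable (\<lambda>n. (ell2_nth (X k) n - l n)\<^sup>2)"
    if "\<And>N. (\<Sum>n<N. (ell2_nth (X k) n - l n)\<^sup>2) \<le> c" for k c
    using that by (intro summableI_nonneg_bounded) auto
  obtain k where "\<And>N. (\<Sum>n<N. (ell2_nth (X k) n - l n)\<^sup>2) \<le> 1\<^sup>2"
    using tail[of 1] by auto
  then have "summable (\<lambda>n. (ell2_nth (X k) n - l n)\<^sup>2)"
    by (rule diff_summable)
  from square_summable_diff[OF summable_ell2_nth_square[of "X k"] this]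
  have "summable (\<lambda>n. (l n)\<^sup>2)"
    by simp
  then have nth_L: "ell2_nth (Abs_ell2 l) = l"
    by (simp add: Abs_ell2_inverse)
  have "X \<longlonglongrightarrow> Abs_ell2 l"
  proof (rule metric_LIMSEQ_I)
    fix e :: real
    assume "e > 0"
    then obtain M where M: "\<And>k N. k \<ge> M \<Longrightarrow> (\<Sum>n<N. (ell2_nth (X k) n - l n)\<^sup>2) \<le> (e/2)\<^sup>2"
      using tail[of "e/2"] by auto
    have "dist (X k) (Abs_ell2 l) < e" if "k \<ge> M" for k
    proof -
      have "(norm (X k - Abs_ell2 l))\<^sup>2 \<le> (e/2)\<^sup>2"
        unfolding norm_ell2_square minus_ell2.rep_eq nth_L
        by (intro suminf_le_const diff_summable[of k "(e/2)\<^sup>2"] M that)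
      then have "norm (X k - Abs_ell2 l) \<le> e/2"
        by (rule power2_le_imp_le) (use \<open>e > 0\<close> in simp)
      then show ?thesis
        using \<open>e > 0\<close> by (simp add: dist_norm)
    qed
    then show "\<exists>M. \<forall>k\<ge>M. dist (X k) (Abs_ell2 l) < e"
      by blast
  qed
  then show "convergent X"
    by (auto simp: convergent_def)
qed

section \<open>Bases and the embedding\<close>

definition metric_basis :: "'a::metric_space set \<Rightarrow> (nat \<Rightarrow> 'a) \<Rightarrow> bool"
  where "metric_basis X xs \<longleftrightarrow>
    (\<forall>n. xs n \<in> X) \<and> (\<forall>x\<in>X. \<forall>\<epsilon>>0. \<exists>n. dist x (xs n) \<le> \<epsilon>)"

definition c_phi :: "real \<Rightarrow> real"
  where "c_phi q = sqrt (q\<^sup>2 - 1) / q"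

definition phi_seq :: "real \<Rightarrow> (nat \<Rightarrow> 'a::metric_space) \<Rightarrow> 'a \<Rightarrow> nat \<Rightarrow> real"
  where "phi_seq q xs x n = c_phi q * dist x (xs n) / q ^ n"

(* Abs_ell2 is underspecified outside the square-summable sequences, so phi is the intended map
   only at points x where phi_seq q xs x is square-summable. *)
definition phi :: "real \<Rightarrow> (nat \<Rightarrow> 'a::metric_space) \<Rightarrow> 'a \<Rightarrow> ell2"
  where "phi q xs x = Abs_ell2 (phi_seq q xs x)"

end

theory Submission
  imports Defs
begin

text \<open>
  The squared weights \<open>(c_phi q / q ^ n)\<^sup>2\<close> form a geometric series with sum \<open>1\<close>, so a bound on the
  coordinates \<open>dist x (xs n)\<close>, or on their differences, passes unchanged to the \<open>\<ell>\<^sup>2\<close> norm.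
  Injectivity holds because a point is determined by its distances to a dense sequence.
\<close>

text \<open>The constant is chosen for this: \<open>(c_phi q)\<^sup>2\<close> equals
  \<open>1 - 1 / q\<^sup>2\<close>, the reciprocal of the sum of the geometric series with ratio
  \<open>1 / q\<^sup>2\<close>.\<close>

lemma c_phi_weights_sums_1:
  assumes "q > 1"
  shows "(\<lambda>n. (c_phi q / q ^ n)\<^sup>2) sums 1"
proof -
  have q2: "q\<^sup>2 > 1"
    using assms by (simp add: one_less_power)
  have "(\<lambda>n. (c_phi q)\<^sup>2 * (1 / q\<^sup>2) ^ n) sums ((c_phi q)\<^sup>2 * (1 / (1 - 1 / q\<^sup>2)))"
    using q2 by (intro sums_mult geometric_sums) (simp add: divide_less_eq)
  moreover have "(c_phi q)\<^sup>2 * (1 / (1 - 1 / q\<^sup>2)) = 1"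
    using q2 assms by (simp add: c_phi_def power_divide field_simps)
  moreover have "(c_phi q)\<^sup>2 * (1 / q\<^sup>2) ^ n = (c_phi q / q ^ n)\<^sup>2" for n
    by (simp add: power_divide power_mult[symmetric] mult.commute)
  ultimately show ?thesis
    by (simp only:)
qed

text \<open>Serves twice: with \<open>t\<close> the distances to the basis points it places the
  image in square-summable sequences, and with \<open>t\<close> the differences of two such
  distances it gives the Lipschitz bound.\<close>

lemma c_phi_weighted_square_summable:
  assumes "q > 1" and bound: "\<And>n. \<bar>t n\<bar> \<le> B"
  shows "summable (\<lambda>n. (c_phi q * t n / q ^ n)\<^sup>2)"
    and "(\<Sum>n. (c_phi q * t n / q ^ n)\<^sup>2) \<le> B\<^sup>2"
proof -
  have majorant: "(\<lambda>n. (c_phi q / q ^ n)\<^sup>2 * B\<^sup>2) sums B\<^sup>2"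
    using sums_mult2[OF c_phi_weights_sums_1[OF assms(1)]] by simp
  have le: "(c_phi q * t n / q ^ n)\<^sup>2 \<le> (c_phi q / q ^ n)\<^sup>2 * B\<^sup>2" for n
  proof -
    have "(t n)\<^sup>2 \<le> B\<^sup>2"
      using power_mono[OF bound[of n], of 2] by simp
    then have "(c_phi q / q ^ n)\<^sup>2 * (t n)\<^sup>2 \<le> (c_phi q / q ^ n)\<^sup>2 * B\<^sup>2"
      by (rule mult_left_mono) simp
    then show ?thesis
      by (simp add: power_divide power_mult_distrib)
  qed
  show summable: "summable (\<lambda>n. (c_phi q * t n / q ^ n)\<^sup>2)"
    using le by (intro summable_comparison_test'[OF sums_summable[OF majorant]]) simp
  show "(\<Sum>n. (c_phi q * t n / q ^ n)\<^sup>2) \<le> B\<^sup>2"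
    using suminf_le[OF le summable sums_summable[OF majorant]] sums_unique[OF majorant] by simp
qed

lemma phi_seq_square_summable:
  assumes "bounded X" "range xs \<subseteq> X" "q > 1" "x \<in> X"
  shows "summable (\<lambda>n. (phi_seq q xs x n)\<^sup>2)"
  unfolding phi_seq_def
proof (rule c_phi_weighted_square_summable(1)[OF assms(3)])
  show "\<bar>dist x (xs n)\<bar> \<le> diameter X" for n
    using diameter_bounded_bound[OF assms(1,4)] assms(2) by auto
qed

lemma ell2_nth_phi:
  assumes "summable (\<lambda>n. (phi_seq q xs x n)\<^sup>2)"
  shows "ell2_nth (phi q xs x) = phi_seq q xs x"
  using assms by (simp add: phi_def Abs_ell2_inverse)

text \<open>By the reverse triangle inequality each difference of distances is at most
  \<open>dist x y\<close>; since the squared weights sum to 1, no extra factor appears.\<close>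

lemma dist_phi_le:
  assumes "summable (\<lambda>n. (phi_seq q xs x n)\<^sup>2)" "summable (\<lambda>n. (phi_seq q xs y n)\<^sup>2)" "q > 1"
  shows "dist (phi q xs x) (phi q xs y) \<le> dist x y"
proof -
  have "\<bar>dist x (xs n) - dist y (xs n)\<bar> \<le> dist x y" for n
    using abs_dist_diff_le[of x "xs n" y] by (simp add: dist_commute)
  from c_phi_weighted_square_summable(2)[OF assms(3) this]
  have "(\<Sum>n. (phi_seq q xs x n - phi_seq q xs y n)\<^sup>2) \<le> (dist x y)\<^sup>2"
    by (simp add: phi_seq_def right_diff_distrib diff_divide_distrib)
  then have "(norm (phi q xs x - phi q xs y))\<^sup>2 \<le> (dist x y)\<^sup>2"
    by (simp add: norm_ell2_square minus_ell2.rep_eq ell2_nth_phi assms)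
  then show ?thesis
    unfolding dist_norm[of "phi q xs x"] by (rule power2_le_imp_le) simp
qed

text \<open>A basis point close to \<open>x\<close> is equally close to \<open>y\<close>, so the
  triangle inequality forces \<open>x\<close> and \<open>y\<close> together.\<close>

lemma metric_basis_dist_eqD:
  assumes "metric_basis X xs" "x \<in> X" and eq: "\<And>n. dist x (xs n) = dist y (xs n)"
  shows "x = y"
proof (rule ccontr)
  assume "x \<noteq> y"
  \<comment> \<open>Any fraction below one half would do: twice the radius must stay strictly under
    \<open>dist x y\<close>, as the basis only provides a non-strict bound.\<close>
  then have "dist x y / 3 > 0"
    by simp
  with assms(1,2) obtain n where "dist x (xs n) \<le> dist x y / 3"
    unfolding metric_basis_def by blast
  with eq[of n] dist_triangle2[of x y "xs n"] \<open>dist x y / 3 > 0\<close> show False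
    by linarith
qed

theorem proposition5:
  fixes X :: "'a::metric_space set" and xs :: "nat \<Rightarrow> 'a" and q :: real
  assumes "X \<noteq> {}" and "compact X" and "diameter X > 0"
    and "metric_basis X xs" and "q > 1"
  shows "(\<forall>x\<in>X. summable (\<lambda>n. (phi_seq q xs x n)\<^sup>2)) \<and>
    1-lipschitz_on X (phi q xs) \<and> inj_on (phi q xs) X"
proof (intro conjI)
  have "range xs \<subseteq> X"
    using assms(4) by (auto simp: metric_basis_def)
  then have summable: "summable (\<lambda>n. (phi_seq q xs x n)\<^sup>2)" if "x \<in> X" for x
    using phi_seq_square_summable compact_imp_bounded[OF assms(2)] assms(5) that by blast
  then show "\<forall>x\<in>X. summable (\<lambda>n. (phi_seq q xs x n)\<^sup>2)"
    by blast
  show "1-lipschitz_on X (phi q xs)"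
    using dist_phi_le[OF summable summable assms(5)] by (intro lipschitz_onI) simp_all
  show "inj_on (phi q xs) X"
  proof (rule inj_onI)
    fix x y
    assume xy: "x \<in> X" "y \<in> X" "phi q xs x = phi q xs y"
    \<comment> \<open>Square-summability at both points is what allows \<open>Abs_ell2\<close> to be
      undone here.\<close>
    then have "phi_seq q xs x = phi_seq q xs y"
      using ell2_nth_phi summable by metis
    then have "c_phi q * dist x (xs n) / q ^ n = c_phi q * dist y (xs n) / q ^ n" for n
      unfolding phi_seq_def by (rule fun_cong)
    \<comment> \<open>This keeps the square root in \<open>c_phi q\<close> from vanishing, so the
      weights can be cancelled.\<close>
    moreover have "q\<^sup>2 \<noteq> 1"
      using one_less_power[OF assms(5), of 2] by simp
    then have "c_phi q \<noteq> 0"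
      using assms(5) by (simp add: c_phi_def)
    ultimately have "dist x (xs n) = dist y (xs n)" for n
      using assms(5) by simp
    then show "x = y"
      by (rule metric_basis_dist_eqD[OF assms(4) xy(1)])
  qed
qed

end
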